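(* For each integer $q\ge2$ let $\widetilde{\mathfrak R}^q$ be the convex hull of the set of all $q!$ permutations of the vector $\bar{\bf y}^q=\left(-\frac{q-1}{2},-\frac{q-3}{2},\dots,\frac{q-3}{2},\frac{q-1}{2}\right)'$ (the regular permutohedron, translated to be centered at the origin), and let $\widetilde{\mathfrak B}^q$ be the ball in which it is inscribed. Then, as $q\to\infty$, $$\frac{\mathrm{Vol}(\widetilde{\mathfrak R}^q)}{\mathrm{Vol}(\widetilde{\mathfrak B}^q)}\to0$$ at a geometric rate.
   Context: Let $\widetilde{\mathcal M}^{q-1}=\{{\bf v}\in\mathbb{R}^q:\sum_i v_i=0\}$, a $(q-1)$-dimensional Euclidean space containing $\widetilde{\mathfrak R}^q$. The ball is $\widetilde{\mathfrak B}^q=\{{\bf v}\in\widetilde{\mathcal M}^{q-1}:\|{\bf v}\|\le\|\bar{\bf y}^q\|\}$, with Euclidean norm, where $\|\bar{\bf y}^q\|=\sqrt{q(q^2-1)/12}$. $\mathrm{Vol}$ denotes $(q-1)$-dimensional Lebesgue volume in $\widetilde{\mathcal M}^{q-1}$. A sequence $r_q\ge0$ converges to $0$ at a geometric rate if there are constants $c>0$ and $0<\theta<1$ with $r_q\le c\,\theta^q$ for all sufficiently large $q$. *)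

theory Defs
  imports
    "HOL-Analysis.Analysis"
    "HOL-Library.Function_Algebras"
    "HOL-Combinatorics.Permutations"
begin

text \<open>
  The dimension \<open>q\<close> is a variable of the statement, so \<open>\<real>\<^sup>q\<close> is the space of functions
  \<open>v :: nat \<Rightarrow> real\<close> with \<open>v i = 0\<close> for \<open>i \<ge> q\<close>; coordinates are numbered \<open>0, \<dots>, q - 1\<close>.
  The pointwise vector space structure makes the library's \<open>convex hull\<close> and \<open>span\<close> available.
\<close>

instantiation "fun" :: (type, real_vector) real_vector
begin

definition scaleR_fun :: "real \<Rightarrow> ('a \<Rightarrow> 'b) \<Rightarrow> 'a \<Rightarrow> 'b" where
  "scaleR_fun c f = (\<lambda>x. c *\<^sub>R f x)"

instance
  by standard (simp_all add: scaleR_fun_def fun_eq_iff scaleR_add_right scaleR_add_left)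

end

lemma scaleR_fun_apply [simp]: "(c *\<^sub>R f) x = c *\<^sub>R f x"
  by (simp add: scaleR_fun_def)

definition hyperplane :: "nat \<Rightarrow> (nat \<Rightarrow> real) set" where
  "hyperplane q = {v. (\<forall>i\<ge>q. v i = 0) \<and> (\<Sum>i<q. v i) = 0}"

definition ybar :: "nat \<Rightarrow> nat \<Rightarrow> real" where
  "ybar q = (\<lambda>i. if i < q then real i - (real q - 1) / 2 else 0)"

definition permutohedron :: "nat \<Rightarrow> (nat \<Rightarrow> real) set" where
  "permutohedron q = convex hull {ybar q \<circ> \<sigma> |\<sigma>. \<sigma> permutes {..<q}}"

definition circumball :: "nat \<Rightarrow> (nat \<Rightarrow> real) set" where
  "circumball q = {v \<in> hyperplane q. L2_set v {..<q} \<le> L2_set (ybar q) {..<q}}"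

lemma L2_set_ybar: "L2_set (ybar q) {..<q} = sqrt (real q * ((real q)\<^sup>2 - 1) / 12)"
proof -
  have "(\<Sum>i<n. (real i - c)\<^sup>2) =
      real n * (real n - 1) * (2 * real n - 1) / 6 - c * real n * (real n - 1) + real n * c\<^sup>2" for n c
    by (induction n) (simp_all add: field_simps power2_eq_square)
  from this[of "(real q - 1) / 2" q] show ?thesis
    by (simp add: L2_set_def ybar_def field_simps power2_eq_square)
qed

definition orthonormal_basis :: "nat \<Rightarrow> (nat \<Rightarrow> nat \<Rightarrow> real) \<Rightarrow> bool" where
  "orthonormal_basis q b \<longleftrightarrow>
     (\<forall>j<q - 1. \<forall>k<q - 1. (\<Sum>i<q. b j i * b k i) = (if j = k then 1 else 0)) \<and>
     span (b ` {..<q - 1}) = hyperplane q"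

text \<open>
  \<open>(q - 1)\<close>-dimensional Lebesgue volume on \<open>hyperplane q\<close>: Lebesgue measure on \<open>\<real>\<^bsup>q - 1\<^esup>\<close>,
  transported by the linear isometry taking \<open>x\<close> to the vector with coordinates \<open>x\<close> in the
  orthonormal basis \<open>b\<close>. By orthogonal invariance of Lebesgue measure the value does not depend
  on the choice of \<open>b\<close>.
\<close>

definition Vol :: "nat \<Rightarrow> (nat \<Rightarrow> nat \<Rightarrow> real) \<Rightarrow> (nat \<Rightarrow> real) set \<Rightarrow> real" where
  "Vol q b S =
     measure (completion (\<Pi>\<^sub>M k\<in>{..<q - 1}. lborel))
       {x \<in> {..<q - 1} \<rightarrow>\<^sub>E UNIV. (\<Sum>k<q - 1. x k *\<^sub>R b k) \<in> S}"

definition geometric_rate_to_0 :: "(nat \<Rightarrow> real) \<Rightarrow> bool" where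
  "geometric_rate_to_0 r \<longleftrightarrow>
     (\<forall>q. 0 \<le> r q) \<and>
     (\<exists>c>0. \<exists>\<theta>. 0 < \<theta> \<and> \<theta> < 1 \<and> (\<forall>\<^sub>F q in sequentially. r q \<le> c * \<theta> ^ q))"


text \<open>Orthonormal bases of the hyperplane exist (the Helmert basis).\<close>

definition helmert :: "nat \<Rightarrow> nat \<Rightarrow> real" where
  "helmert k = (\<lambda>i. (if i \<le> k then 1 else if i = Suc k then - real (Suc k) else 0) /
     sqrt (real (Suc k) * real (Suc (Suc k))))"

lemma hyperplane_subspace: "subspace (hyperplane q)"
  by (auto simp: subspace_def hyperplane_def sum.distrib simp flip: sum_distrib_left)

lemma sum_helmert:
  assumes "j < k"
  shows "(\<Sum>i\<le>k. helmert j i) = 0"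
proof -
  have "(\<Sum>i\<le>k. helmert j i) = (\<Sum>i\<le>Suc j. helmert j i)"
    using assms by (intro sum.mono_neutral_right) (auto simp: helmert_def)
  also have "\<dots> = 0"
    by (simp add: helmert_def divide_simps)
  finally show ?thesis .
qed

lemma helmert_orthogonal:
  assumes "j < k" "Suc k < q"
  shows "(\<Sum>i<q. helmert j i * helmert k i) = 0"
proof -
  have "(\<Sum>i<q. helmert j i * helmert k i) = (\<Sum>i\<le>k. helmert j i * helmert k i)"
    using assms by (intro sum.mono_neutral_right) (auto simp: helmert_def)
  also have "\<dots> = (\<Sum>i\<le>k. helmert j i) / sqrt (real (Suc k) * real (Suc (Suc k)))"
    unfolding sum_divide_distrib by (intro sum.cong) (auto simp: helmert_def)
  finally show ?thesis
    using sum_helmert[OF assms(1)] by simp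
qed

lemma helmert_normal:
  assumes "Suc k < q"
  shows "(\<Sum>i<q. helmert k i * helmert k i) = 1"
proof -
  have "(\<Sum>i<q. helmert k i * helmert k i) = (\<Sum>i\<le>Suc k. helmert k i * helmert k i)"
    using assms by (intro sum.mono_neutral_right) (auto simp: helmert_def)
  also have "\<dots> = (\<Sum>i\<le>k. 1 / (real (Suc k) * real (Suc (Suc k)))) +
      (real (Suc k))\<^sup>2 / (real (Suc k) * real (Suc (Suc k)))"
    unfolding sum.atMost_Suc
    by (intro arg_cong2[of _ _ _ _ "(+)"] sum.cong)
       (simp_all add: helmert_def field_simps power2_eq_square flip: real_sqrt_mult)
  also have "\<dots> = 1"
    by (simp add: divide_simps power2_eq_square)
  finally show ?thesis .
qed

lemma helmert_in_hyperplane: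
  assumes "Suc k < q"
  shows "helmert k \<in> hyperplane q"
  using sum_helmert[of k "q - 1"] assms
  by (cases q) (auto simp: hyperplane_def lessThan_Suc_atMost helmert_def)

lemma hyperplane_subset_span:
  "v \<in> hyperplane (Suc n) \<Longrightarrow> v \<in> span (helmert ` {..<n})"
proof (induction n arbitrary: v)
  case 0
  have "v i = 0" for i
    using 0 by (cases i) (auto simp: hyperplane_def)
  then have "v = 0"
    by (simp add: fun_eq_iff)
  then show ?case
    by (simp only: span_zero)
next
  case (Suc n)
  define a where "a = v (Suc n) / helmert n (Suc n)"
  define w where "w = v - a *\<^sub>R helmert n"
  have "w \<in> hyperplane (Suc (Suc n))"
    unfolding w_def using Suc.prems
    by (intro subspace_diff subspace_scale hyperplane_subspace helmert_in_hyperplane) auto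
  moreover have "w (Suc n) = 0"
    by (simp add: w_def a_def helmert_def)
  ultimately have "w \<in> hyperplane (Suc n)"
    by (auto simp: hyperplane_def) (metis le_antisym not_less_eq_eq)
  then have "w \<in> span (helmert ` {..<Suc n})"
    using Suc.IH span_mono[OF image_mono[of "{..<n}" "{..<Suc n}"]] by auto
  moreover have "helmert n \<in> span (helmert ` {..<Suc n})"
    by (intro span_base) auto
  moreover have "v = w + a *\<^sub>R helmert n"
    by (simp add: w_def)
  ultimately show ?case
    by (metis span_add span_scale)
qed

lemma orthonormal_basis_helmert:
  assumes "q \<ge> 2"
  shows "orthonormal_basis q helmert"
proof -
  obtain n where q: "q = Suc n"
    using assms by (cases q) auto
  have "span (helmert ` {..<q - 1}) = hyperplane q"
  proof
    show "span (helmert ` {..<q - 1}) \<subseteq> hyperplane q"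
      by (intro span_minimal hyperplane_subspace) (auto intro: helmert_in_hyperplane)
    show "hyperplane q \<subseteq> span (helmert ` {..<q - 1})"
      using hyperplane_subset_span by (auto simp: q)
  qed
  moreover have "(\<Sum>i<q. helmert j i * helmert k i) = (if j = k then 1 else 0)"
    if "j < q - 1" "k < q - 1" for j k
    using that helmert_normal[of j q] helmert_orthogonal[of j k q] helmert_orthogonal[of k j q]
    by (cases j k rule: linorder_cases) (auto simp: mult.commute)
  ultimately show ?thesis
    unfolding orthonormal_basis_def by blast
qed

end

theory Submission
  imports Defs "HOL-Real_Asymp.Real_Asymp"
begin

text \<open>
  The permutohedron lies in the cube of side \<open>q - 1\<close>, and the central section of that cube by the
  hyperplane has volume at most \<open>\<surd>q q\<^sup>q\<^sup>-\<^sup>1\<close>. The ball has radius of order \<open>q\<^sup>3\<^sup>/\<^sup>2 / \<surd>12\<close>, and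
  Stirling's upper bound for \<open>\<Gamma>((q - 1) / 2 + 1)\<close> shows that the quotient of the volumes is, up to a
  factor polynomial in \<open>q\<close>, at most \<open>(6 / (\<pi> e))\<^bsup>(q - 1) / 2\<^esup>\<close>. Although the cube is much larger than
  the permutohedron, this already tends to \<open>0\<close> since \<open>\<pi> e > 6\<close>.
\<close>

section \<open>Orthogonal invariance of product Lebesgue measure\<close>

abbreviation lborel_on :: "'i set \<Rightarrow> ('i \<Rightarrow> real) measure" where
  "lborel_on I \<equiv> \<Pi>\<^sub>M k\<in>I. lborel"

interpretation lborel_product: product_sigma_finite "\<lambda>_::'i. lborel :: real measure"
  by standard

text \<open>The product measure is determined by its values on boxes, where the claim is
  one-dimensional translation invariance in each coordinate. Restricting to \<open>I\<close> keeps
  the translate extensional, as points of the product space are.\<close>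

lemma nn_integral_lborel_on_translate:
  fixes z :: "'i \<Rightarrow> real"
  assumes I: "finite I" and f [measurable]: "f \<in> borel_measurable (lborel_on I)"
  shows "(\<integral>\<^sup>+x. f (\<lambda>i\<in>I. z i + x i) \<partial>lborel_on I) = (\<integral>\<^sup>+x. f x \<partial>lborel_on I)"
proof -
  let ?t = "\<lambda>x. \<lambda>i\<in>I. z i + x i"
  have [measurable]: "?t \<in> lborel_on I \<rightarrow>\<^sub>M lborel_on I"
    by (intro measurable_restrict) simp
  have "distr (lborel_on I) (lborel_on I) ?t = lborel_on I"
  proof (rule lborel_product.PiM_eqI)
    fix A :: "'i \<Rightarrow> real set"
    assume A: "\<And>i. i \<in> I \<Longrightarrow> A i \<in> sets lborel"
    have [simp]: "(+) (z i) -` A i \<in> sets borel" if "i \<in> I" for i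
      using A[OF that] measurable_sets[of "(+) (z i)" borel borel "A i"] by simp
    have "emeasure (distr (lborel_on I) (lborel_on I) ?t) (Pi\<^sub>E I A) =
        emeasure (lborel_on I) (?t -` Pi\<^sub>E I A \<inter> space (lborel_on I))"
      using A I by (intro emeasure_distr sets_PiM_I_finite) auto
    also have "?t -` Pi\<^sub>E I A \<inter> space (lborel_on I) = (\<Pi>\<^sub>E i\<in>I. (+) (z i) -` A i)"
      by (auto simp: space_PiM PiE_iff extensional_def)
    also have "emeasure (lborel_on I) \<dots> = (\<Prod>i\<in>I. emeasure lborel ((+) (z i) -` A i))"
      using I by (intro lborel_product.emeasure_PiM) auto
    also have "\<dots> = (\<Prod>i\<in>I. emeasure lborel (A i))"
    proof (intro prod.cong refl)
      fix i assume i: "i \<in> I"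
      have "emeasure lborel (A i) = emeasure (distr lborel borel ((+) (z i))) (A i)"
        by (simp add: lborel_distr_plus)
      also have "\<dots> = emeasure lborel ((+) (z i) -` A i)"
        using A[OF i] by (subst emeasure_distr) auto
      finally show "emeasure lborel ((+) (z i) -` A i) = emeasure lborel (A i)" ..
    qed
    finally show "emeasure (distr (lborel_on I) (lborel_on I) ?t) (Pi\<^sub>E I A) =
      (\<Prod>i\<in>I. emeasure lborel (A i))" .
  qed (use I in auto)
  then have "(\<integral>\<^sup>+x. f x \<partial>lborel_on I) = (\<integral>\<^sup>+x. f x \<partial>distr (lborel_on I) (lborel_on I) ?t)"
    by simp
  then show ?thesis
    by (simp add: nn_integral_distr)
qed

text \<open>Supplies the normalizing constant of the Haar argument below, where it matters that this
  value is positive and finite.\<close>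

lemma emeasure_unit_ball_lborel_on:
  assumes "finite I"
  shows "emeasure (lborel_on I) {x \<in> space (lborel_on I). (\<Sum>i\<in>I. (x i)\<^sup>2) \<le> 1} =
    ennreal (unit_ball_vol (card I))"
proof -
  have "{x \<in> space (lborel_on I). (\<Sum>i\<in>I. (x i)\<^sup>2) \<le> 1} =
      {x. sqrt (\<Sum>i\<in>I. (x i)\<^sup>2) \<le> 1} \<inter> space (lborel_on I)"
    by auto
  then show ?thesis
    using emeasure_cball_aux[OF assms, of 1] by simp
qed

text \<open>The linear map whose matrix has the columns \<open>c k\<close>.\<close>

definition combine :: "'i set \<Rightarrow> ('i \<Rightarrow> 'i \<Rightarrow> real) \<Rightarrow> ('i \<Rightarrow> real) \<Rightarrow> 'i \<Rightarrow> real" where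
  "combine I c x = (\<lambda>i\<in>I. \<Sum>k\<in>I. x k * c k i)"

lemma measurable_combine [measurable]: "combine I c \<in> lborel_on I \<rightarrow>\<^sub>M lborel_on I"
  unfolding combine_def by (intro measurable_restrict) measurable

text \<open>\<open>K\<close> and \<open>I\<close> are separate so that the lemma covers both
  orthogonal maps on one index set and the isometric embedding of coordinates into the hyperplane,
  which has one more ambient dimension.\<close>

lemma sum_orthonormal_square:
  fixes c :: "'k \<Rightarrow> 'i \<Rightarrow> real"
  assumes K: "finite K"
    and on: "\<And>j k. j \<in> K \<Longrightarrow> k \<in> K \<Longrightarrow> (\<Sum>i\<in>I. c j i * c k i) = of_bool (j = k)"
  shows "(\<Sum>i\<in>I. (\<Sum>k\<in>K. x k * c k i)\<^sup>2) = (\<Sum>k\<in>K. (x k)\<^sup>2)"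
proof -
  have "(\<Sum>i\<in>I. (\<Sum>k\<in>K. x k * c k i)\<^sup>2) =
      (\<Sum>i\<in>I. \<Sum>j\<in>K. \<Sum>k\<in>K. x j * x k * (c j i * c k i))"
    by (simp add: power2_eq_square sum_product mult_ac)
  also have "\<dots> = (\<Sum>j\<in>K. \<Sum>i\<in>I. \<Sum>k\<in>K. x j * x k * (c j i * c k i))"
    by (rule sum.swap)
  also have "\<dots> = (\<Sum>j\<in>K. \<Sum>k\<in>K. \<Sum>i\<in>I. x j * x k * (c j i * c k i))"
    by (intro sum.cong refl sum.swap)
  also have "\<dots> = (\<Sum>j\<in>K. \<Sum>k\<in>K. x j * x k * of_bool (j = k))"
    by (simp add: on flip: sum_distrib_left)
  also have "\<dots> = (\<Sum>k\<in>K. (x k)\<^sup>2)"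
  proof (intro sum.cong refl)
    fix j assume "j \<in> K"
    have "(\<Sum>k\<in>K. x j * x k * of_bool (j = k)) = (\<Sum>k\<in>K. if k = j then x j * x k else 0)"
      by (intro sum.cong) auto
    then show "(\<Sum>k\<in>K. x j * x k * of_bool (j = k)) = (x j)\<^sup>2"
      using K \<open>j \<in> K\<close> by (simp add: power2_eq_square)
  qed
  finally show ?thesis .
qed

text \<open>
  The uniqueness argument for Haar measure: both integrals are compared through the double
  integral of \<open>g x * f (x + U y)\<close>, where \<open>g\<close> is the indicator of the unit ball.
\<close>

lemma nn_integral_lborel_on_orthogonal:
  fixes c :: "'i \<Rightarrow> 'i \<Rightarrow> real"
  assumes I: "finite I"
    and cols: "\<And>j k. j \<in> I \<Longrightarrow> k \<in> I \<Longrightarrow> (\<Sum>i\<in>I. c j i * c k i) = of_bool (j = k)"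
    and rows: "\<And>i j. i \<in> I \<Longrightarrow> j \<in> I \<Longrightarrow> (\<Sum>k\<in>I. c k i * c k j) = of_bool (i = j)"
    and f [measurable]: "f \<in> borel_measurable (lborel_on I)"
  shows "(\<integral>\<^sup>+y. f (combine I c y) \<partial>lborel_on I) = (\<integral>\<^sup>+y. f y \<partial>lborel_on I)"
proof -
  let ?M = "lborel_on I"
  let ?U = "combine I c"
  interpret finite_product_sigma_finite "\<lambda>_. lborel :: real measure" I
    by standard (rule I)
  interpret pair_sigma_finite ?M ?M
    by standard
  define g :: "('i \<Rightarrow> real) \<Rightarrow> ennreal" where "g x = indicator {x. (\<Sum>i\<in>I. (x i)\<^sup>2) \<le> 1} x" for x
  define s where "s x y = (\<lambda>i\<in>I. x i + ?U y i)" for x y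
  define d where "d x y = (\<lambda>i\<in>I. - ?U y i + x i)" for x y
  \<comment> \<open>\<open>w x\<close> applies the transpose to \<open>x\<close>. Since the rows are
    orthonormal, it is a preimage of \<open>x\<close> under \<open>?U\<close>, so shifting
    \<open>y\<close> by \<open>w x\<close> shifts \<open>?U y\<close> by \<open>x\<close>.\<close>
  define w where "w x k = (\<Sum>i\<in>I. x i * c k i)" for x k
  have [measurable]: "g \<in> borel_measurable ?M"
    unfolding g_def by measurable
  have U_eval [measurable]: "(\<lambda>y. ?U y i) \<in> borel_measurable ?M" if "i \<in> I" for i
    using measurable_compose[OF measurable_combine measurable_component_singleton[OF that]] by simp
  have [measurable]: "case_prod s \<in> ?M \<Otimes>\<^sub>M ?M \<rightarrow>\<^sub>M ?M" "case_prod d \<in> ?M \<Otimes>\<^sub>M ?M \<rightarrow>\<^sub>M ?M"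
    unfolding s_def d_def case_prod_beta by (intro measurable_restrict; measurable)+
  have w_inv: "(\<Sum>k\<in>I. w x k * c k i) = x i" if "i \<in> I" for x i
  proof -
    have "(\<Sum>k\<in>I. w x k * c k i) = (\<Sum>j\<in>I. x j * (\<Sum>k\<in>I. c k j * c k i))"
      unfolding w_def sum_distrib_right sum_distrib_left by (subst sum.swap) (simp add: mult_ac)
    also have "\<dots> = (\<Sum>j\<in>I. if j = i then x j else 0)"
      using that by (intro sum.cong) (auto simp: rows)
    finally show ?thesis
      using that I by simp
  qed
  have U_shift: "?U (\<lambda>k\<in>I. w x k + y k) i = x i + ?U y i" if "i \<in> I" for x y i
    using that by (simp add: combine_def distrib_right sum.distrib w_inv)
  have "(\<integral>\<^sup>+x. g x \<partial>?M) = emeasure ?M {x \<in> space ?M. (\<Sum>i\<in>I. (x i)\<^sup>2) \<le> 1}"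
  proof -
    have "(\<integral>\<^sup>+x. g x \<partial>?M) =
        (\<integral>\<^sup>+x. indicator {x \<in> space ?M. (\<Sum>i\<in>I. (x i)\<^sup>2) \<le> 1} x \<partial>?M)"
      by (intro nn_integral_cong) (simp add: g_def indicator_def)
    also have "\<dots> = emeasure ?M {x \<in> space ?M. (\<Sum>i\<in>I. (x i)\<^sup>2) \<le> 1}"
      by (rule nn_integral_indicator) measurable
    finally show ?thesis .
  qed
  then have K: "(\<integral>\<^sup>+x. g x \<partial>?M) = ennreal (unit_ball_vol (card I))"
    by (simp add: emeasure_unit_ball_lborel_on I)
  \<comment> \<open>The shift by \<open>w x\<close> turns \<open>d x y\<close> into
    \<open>- ?U y\<close>, whose norm is that of \<open>y\<close>, and \<open>g\<close> depends on
    the norm only.\<close>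
  have g_int: "(\<integral>\<^sup>+y. g (d x y) \<partial>?M) = (\<integral>\<^sup>+y. g y \<partial>?M)" if "x \<in> space ?M" for x
  proof -
    have "(\<integral>\<^sup>+y. g (d x y) \<partial>?M) = (\<integral>\<^sup>+y. g (d x (\<lambda>k\<in>I. w x k + y k)) \<partial>?M)"
      using that by (intro nn_integral_lborel_on_translate[symmetric] I) measurable
    also have "\<dots> = (\<integral>\<^sup>+y. g y \<partial>?M)"
    proof (intro nn_integral_cong)
      fix y
      have "(\<Sum>i\<in>I. (d x (\<lambda>k\<in>I. w x k + y k) i)\<^sup>2) = (\<Sum>i\<in>I. (\<Sum>k\<in>I. y k * c k i)\<^sup>2)"
        by (intro sum.cong) (auto simp: d_def U_shift, simp add: combine_def)
      then show "g (d x (\<lambda>k\<in>I. w x k + y k)) = g y"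
        by (simp add: g_def sum_orthonormal_square[OF I cols] indicator_def)
    qed
    finally show ?thesis .
  qed
  have "(\<integral>\<^sup>+x. g x \<partial>?M) * (\<integral>\<^sup>+y. f (?U y) \<partial>?M) = (\<integral>\<^sup>+x. g x * (\<integral>\<^sup>+y. f (?U y) \<partial>?M) \<partial>?M)"
    by (simp add: nn_integral_multc)
  also have "\<dots> = (\<integral>\<^sup>+x. \<integral>\<^sup>+y. g x * f (s x y) \<partial>?M \<partial>?M)"
  proof (intro nn_integral_cong)
    fix x assume x: "x \<in> space ?M"
    have "(\<integral>\<^sup>+y. f (?U y) \<partial>?M) = (\<integral>\<^sup>+y. f (?U (\<lambda>k\<in>I. w x k + y k)) \<partial>?M)"
      by (intro nn_integral_lborel_on_translate[symmetric] I) measurable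
    also have "\<dots> = (\<integral>\<^sup>+y. f (s x y) \<partial>?M)"
    proof (intro nn_integral_cong arg_cong[of _ _ f])
      fix y show "?U (\<lambda>k\<in>I. w x k + y k) = s x y"
        by (rule extensionalityI[of _ I]) (simp_all add: s_def U_shift, simp add: combine_def)
    qed
    finally show "g x * (\<integral>\<^sup>+y. f (?U y) \<partial>?M) = (\<integral>\<^sup>+y. g x * f (s x y) \<partial>?M)"
      using x by (simp add: nn_integral_cmult)
  qed
  \<comment> \<open>With \<open>x\<close> as the inner variable, \<open>y\<close> is fixed and
    \<open>x\<close> can be shifted by \<open>- ?U y\<close>. This moves the dependence on
    \<open>y\<close> from \<open>f\<close> to \<open>g\<close>, where \<open>g_int\<close> removes
    it.\<close>
  also have "\<dots> = (\<integral>\<^sup>+y. \<integral>\<^sup>+x. g x * f (s x y) \<partial>?M \<partial>?M)"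
    by (rule Fubini'[symmetric]) measurable
  also have "\<dots> = (\<integral>\<^sup>+y. \<integral>\<^sup>+x. g (d x y) * f x \<partial>?M \<partial>?M)"
  proof (rule nn_integral_cong)
    fix y assume y: "y \<in> space ?M"
    have "(\<integral>\<^sup>+x. g x * f (s x y) \<partial>?M) =
        (\<integral>\<^sup>+x. g (\<lambda>i\<in>I. - ?U y i + x i) * f (s (\<lambda>i\<in>I. - ?U y i + x i) y) \<partial>?M)"
      using y by (intro nn_integral_lborel_on_translate[symmetric] I) measurable
    also have "\<dots> = (\<integral>\<^sup>+x. g (d x y) * f x \<partial>?M)"
    proof (intro nn_integral_cong)
      fix x assume "x \<in> space ?M"
      then have "s (\<lambda>i\<in>I. - ?U y i + x i) y = x"
        by (intro extensionalityI[of _ I]) (auto simp: s_def space_PiM PiE_iff)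
      then show "g (\<lambda>i\<in>I. - ?U y i + x i) * f (s (\<lambda>i\<in>I. - ?U y i + x i) y) = g (d x y) * f x"
        by (simp add: d_def)
    qed
    finally show "(\<integral>\<^sup>+x. g x * f (s x y) \<partial>?M) = (\<integral>\<^sup>+x. g (d x y) * f x \<partial>?M)" .
  qed
  also have "\<dots> = (\<integral>\<^sup>+x. \<integral>\<^sup>+y. g (d x y) * f x \<partial>?M \<partial>?M)"
    by (rule Fubini') measurable
  also have "\<dots> = (\<integral>\<^sup>+x. (\<integral>\<^sup>+y. g y \<partial>?M) * f x \<partial>?M)"
    by (intro nn_integral_cong) (simp add: nn_integral_multc g_int)
  also have "\<dots> = (\<integral>\<^sup>+x. g x \<partial>?M) * (\<integral>\<^sup>+y. f y \<partial>?M)"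
    by (simp add: nn_integral_cmult)
  \<comment> \<open>Both sides carry the factor
    \<open>\<integral>\<^sup>+x. g x \<partial>?M\<close>, which cancels in \<open>ennreal\<close>
    because it is neither 0 nor infinite.\<close>
  finally show ?thesis
    using unit_ball_vol_pos[of "card I"] unfolding K
    by (subst (asm) ennreal_mult_cancel_left) (auto simp del: unit_ball_vol_pos)
qed


section \<open>Completing a basis of the hyperplane\<close>

lemma sum_fun_apply: "(\<Sum>k\<in>A. f k) i = (\<Sum>k\<in>A. f k i)"
  for f :: "'k \<Rightarrow> 'i \<Rightarrow> 'a::comm_monoid_add"
  by (induction A rule: infinite_finite_induct) auto

text \<open>The expansion map is linear and fixes every \<open>b l\<close>, so its fixed points form
  a subspace that contains the span of the basis, which is the hyperplane.\<close>

lemma orthonormal_basis_expansion: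
  assumes b: "orthonormal_basis q b" and v: "v \<in> hyperplane q"
  shows "v i = (\<Sum>k<q - 1. (\<Sum>j<q. v j * b k j) * b k i)"
proof -
  define E where "E v i = (\<Sum>k<q - 1. (\<Sum>j<q. v j * b k j) * b k i)" for v :: "nat \<Rightarrow> real" and i
  have E_add: "E (v + w) = E v + E w" for v w
    by (simp add: E_def fun_eq_iff distrib_right sum.distrib)
  have E_scale: "E (a *\<^sub>R v) = a *\<^sub>R E v" for a v
    by (simp add: E_def fun_eq_iff mult.assoc flip: sum_distrib_left)
  have E_zero: "E 0 = 0"
    by (simp add: E_def fun_eq_iff)
  have "v \<in> span (b ` {..<q - 1})"
    using b v by (simp add: orthonormal_basis_def)
  then have "E v = v"
  proof (induction rule: span_induct)
    case base
    show ?case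
      by (intro subspaceI) (simp_all add: E_add E_scale E_zero)
  next
    case (step v)
    then obtain l where l: "l < q - 1" "v = b l"
      by auto
    have "E v i = (\<Sum>k<q - 1. if k = l then b k i else 0)" for i
      unfolding E_def using b l by (intro sum.cong) (auto simp: orthonormal_basis_def)
    then show ?case
      using l by (simp add: fun_eq_iff)
  qed
  then show ?thesis
    by (metis E_def)
qed

lemma orthonormal_basis_mem:
  assumes "orthonormal_basis q b" "k < q - 1"
  shows "b k \<in> hyperplane q"
  using assms span_base[of "b k" "b ` {..<q - 1}"] by (auto simp: orthonormal_basis_def)

text \<open>The vector added at index \<open>n\<close> is the unit normal of the hyperplane in
  dimension \<open>Suc n\<close>.\<close>

definition completed_basis :: "nat \<Rightarrow> (nat \<Rightarrow> nat \<Rightarrow> real) \<Rightarrow> nat \<Rightarrow> nat \<Rightarrow> real" where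
  "completed_basis n b k i = (if k = n then 1 / sqrt (real (Suc n)) else b k i)"

lemma completed_basis_cols:
  assumes b: "orthonormal_basis (Suc n) b" and jk: "j < Suc n" "k < Suc n"
  shows "(\<Sum>i<Suc n. completed_basis n b j i * completed_basis n b k i) = of_bool (j = k)"
proof -
  have sum0: "(\<Sum>i<Suc n. b k i) = 0" if "k < n" for k
    using orthonormal_basis_mem[OF b, of k] that by (simp add: hyperplane_def)
  have orth: "(\<Sum>i<Suc n. b j i * b k i) = of_bool (j = k)" if "j < n" "k < n" for j k
    using b that by (simp add: orthonormal_basis_def)
  consider "j < n" "k < n" | "j < n" "k = n" | "j = n" "k < n" | "j = n" "k = n"
    using jk by linarith
  then show ?thesis
  proof cases
    case 1
    then show ?thesis
      using orth[of j k]
      unfolding completed_basis_def by (auto simp del: sum.lessThan_Suc)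
  next
    case 2
    then show ?thesis
      using sum0[of j] unfolding completed_basis_def
      by (simp del: sum.lessThan_Suc flip: sum_divide_distrib)
  next
    case 3
    then show ?thesis
      using sum0[of k] unfolding completed_basis_def
      by (simp del: sum.lessThan_Suc flip: sum_divide_distrib)
  next
    case 4
    then show ?thesis
      unfolding completed_basis_def by (simp del: sum.lessThan_Suc flip: real_sqrt_mult)
  qed
qed

text \<open>Expanding the projection of a unit vector onto the hyperplane in the basis
  \<open>b\<close> gives the Kronecker delta minus \<open>1 / Suc n\<close>; the normal vector
  contributes exactly the missing \<open>1 / Suc n\<close>.\<close>

lemma completed_basis_rows:
  assumes b: "orthonormal_basis (Suc n) b" and ij: "i < Suc n" "j < Suc n"
  shows "(\<Sum>k<Suc n. completed_basis n b k i * completed_basis n b k j) = of_bool (i = j)"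
proof -
  \<comment> \<open>The orthogonal projection of the \<open>j\<close>-th unit vector onto the
    hyperplane.\<close>
  define v where "v l = (if l < Suc n then of_bool (l = j) - 1 / real (Suc n) else 0)" for l
  have "(\<Sum>l<Suc n. v l) = (\<Sum>l<Suc n. (if l = j then 1 else 0) - 1 / real (Suc n))"
    by (intro sum.cong) (auto simp: v_def)
  also have "\<dots> = 0"
    using ij unfolding sum_subtractf by (subst sum.delta) auto
  finally have v: "v \<in> hyperplane (Suc n)"
    by (simp add: hyperplane_def v_def)
  have coeff: "(\<Sum>l<Suc n. v l * b k l) = b k j" if "k < n" for k
  proof -
    have "(\<Sum>l<Suc n. v l * b k l) =
        (\<Sum>l<Suc n. (if l = j then b k l else 0) - b k l / real (Suc n))"
      by (intro sum.cong) (auto simp: v_def algebra_simps)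
    also have "\<dots> = b k j - (\<Sum>l<Suc n. b k l) / real (Suc n)"
      using ij unfolding sum_subtractf by (subst sum.delta) (auto simp: sum_divide_distrib simp del: sum.lessThan_Suc)
    also have "(\<Sum>l<Suc n. b k l) = 0"
      using orthonormal_basis_mem[OF b, of k] that by (simp add: hyperplane_def)
    finally show ?thesis
      by simp
  qed
  have "v i = (\<Sum>k<n. (\<Sum>l<Suc n. v l * b k l) * b k i)"
    using orthonormal_basis_expansion[OF b v, of i] by simp
  also have "\<dots> = (\<Sum>k<n. b k i * b k j)"
    by (intro sum.cong refl) (simp only: coeff lessThan_iff mult.commute)
  finally have "(\<Sum>k<n. b k i * b k j) = of_bool (i = j) - 1 / real (Suc n)"
    using ij by (simp add: v_def)
  moreover have "(\<Sum>k<n. completed_basis n b k i * completed_basis n b k j) = (\<Sum>k<n. b k i * b k j)"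
    by (intro sum.cong) (auto simp: completed_basis_def)
  moreover have "completed_basis n b n i * completed_basis n b n j = 1 / real (Suc n)"
    by (simp add: completed_basis_def flip: real_sqrt_mult)
  ultimately show ?thesis
    by simp
qed

section \<open>Volumes of the permutohedron and of the ball\<close>

text \<open>The cube is convex, so checking the vertices suffices. This is the only geometric fact
  about the permutohedron that enters the volume bound.\<close>

lemma permutohedron_subset_cube:
  "permutohedron q \<subseteq> {v. \<forall>i<q. \<bar>v i\<bar> \<le> (real q - 1) / 2}" (is "_ \<subseteq> ?C")
  unfolding permutohedron_def
proof (rule hull_minimal)
  show "{ybar q \<circ> \<sigma> |\<sigma>. \<sigma> permutes {..<q}} \<subseteq> ?C"
  proof (safe, unfold o_apply)
    fix \<sigma> i assume "\<sigma> permutes {..<q}" "i < q"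
    then have "\<sigma> i < q"
      using permutes_in_image[of \<sigma> "{..<q}" i] by auto
    then have "real (\<sigma> i) \<le> real q - 1"
      by linarith
    then show "\<bar>ybar q (\<sigma> i)\<bar> \<le> (real q - 1) / 2"
      using \<open>\<sigma> i < q\<close> by (auto simp: ybar_def abs_le_iff field_simps)
  qed
  show "convex ?C"
  proof (rule convexI, intro CollectI allI impI, unfold plus_fun_apply scaleR_fun_apply real_scaleR_def)
    fix x y :: "nat \<Rightarrow> real" and u v :: real and i
    assume *: "x \<in> ?C" "y \<in> ?C" "0 \<le> u" "0 \<le> v" "u + v = 1" "i < q"
    have "\<bar>u * x i + v * y i\<bar> \<le> u * \<bar>x i\<bar> + v * \<bar>y i\<bar>"
      using * by (metis abs_mult abs_of_nonneg abs_triangle_ineq)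
    also have "\<dots> \<le> u * ((real q - 1) / 2) + v * ((real q - 1) / 2)"
      using * by (intro add_mono mult_left_mono) auto
    also have "\<dots> = (real q - 1) / 2"
      using * by (simp flip: distrib_right)
    finally show "\<bar>u * x i + v * y i\<bar> \<le> (real q - 1) / 2" .
  qed
qed

text \<open>
  Thickening the central section of the cube of side \<open>n\<close> by a segment of length \<open>\<surd>(n + 1)\<close>
  in the normal direction moves each coordinate by at most \<open>1/2\<close>, hence stays inside the cube
  of side \<open>n + 1\<close>.
\<close>

lemma emeasure_cube_section_le:
  fixes b :: "nat \<Rightarrow> nat \<Rightarrow> real"
  assumes b: "orthonormal_basis (Suc n) b"
  defines "S \<equiv> {x \<in> space (lborel_on {..<n}). \<forall>i<Suc n. \<bar>\<Sum>k<n. x k * b k i\<bar> \<le> real n / 2}"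
  shows "emeasure (lborel_on {..<n}) S * ennreal (sqrt (Suc n)) \<le> ennreal (real (Suc n) ^ Suc n)"
proof -
  let ?c = "completed_basis n b" and ?I = "{..<Suc n}"
  define Q where "Q = (\<Pi>\<^sub>E i\<in>?I. {- (real (Suc n) / 2)..real (Suc n) / 2})"
  define T where "T = {- (sqrt (Suc n) / 2)..sqrt (Suc n) / 2}"
  have S [measurable]: "S \<in> sets (lborel_on {..<n})"
    unfolding S_def by measurable
  have Q [measurable]: "Q \<in> sets (lborel_on ?I)"
    unfolding Q_def by (intro sets_PiM_I_finite) auto
  have inside: "combine ?I ?c (x(n := t)) \<in> Q" if "x \<in> S" "t \<in> T" for x t
    unfolding Q_def
  proof (rule PiE_I)
    fix i assume "i \<in> ?I"
    have "combine ?I ?c (x(n := t)) i = (\<Sum>k<n. x k * b k i) + t / sqrt (Suc n)"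
      using \<open>i \<in> ?I\<close> by (auto simp: combine_def completed_basis_def intro!: sum.cong)
    moreover have "\<bar>\<Sum>k<n. x k * b k i\<bar> \<le> real n / 2"
      using \<open>x \<in> S\<close> \<open>i \<in> ?I\<close> by (auto simp: S_def)
    moreover have "\<bar>t / sqrt (Suc n)\<bar> \<le> 1 / 2"
      using \<open>t \<in> T\<close> by (auto simp: T_def abs_le_iff field_simps)
    moreover have "real (Suc n) / 2 = real n / 2 + 1 / 2"
      by simp
    ultimately show "combine ?I ?c (x(n := t)) i \<in> {- (real (Suc n) / 2)..real (Suc n) / 2}"
      unfolding atLeastAtMost_iff by linarith
  qed (simp add: combine_def)
  have "emeasure (lborel_on {..<n}) S * ennreal (sqrt (Suc n)) =
      (\<integral>\<^sup>+x. indicator S x * ennreal (sqrt (Suc n)) \<partial>lborel_on {..<n})"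
    by (simp add: nn_integral_multc)
  also have "\<dots> = (\<integral>\<^sup>+x. \<integral>\<^sup>+t. indicator S x * indicator T t \<partial>lborel \<partial>lborel_on {..<n})"
    by (simp add: nn_integral_cmult T_def)
  also have "\<dots> \<le> (\<integral>\<^sup>+x. \<integral>\<^sup>+t. indicator Q (combine ?I ?c (x(n := t))) \<partial>lborel \<partial>lborel_on {..<n})"
    using inside by (intro nn_integral_mono) (auto simp: indicator_def)
  \<comment> \<open>Fubini: the coordinate \<open>n\<close>, which is the height along the normal,
    is merged with the coordinates in the hyperplane.\<close>
  also have "\<dots> = (\<integral>\<^sup>+y. indicator Q (combine ?I ?c y) \<partial>lborel_on (insert n {..<n}))"
  proof (rule lborel_product.product_nn_integral_insert[symmetric])
    show "(\<lambda>y. indicator Q (combine ?I ?c y)) \<in> borel_measurable (lborel_on (insert n {..<n}))"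
      unfolding lessThan_Suc[symmetric] by measurable
  qed auto
  \<comment> \<open>The completed basis is orthogonal, so the change of coordinates preserves
    volume.\<close>
  also have "\<dots> = (\<integral>\<^sup>+y. indicator Q y \<partial>lborel_on ?I)"
    unfolding lessThan_Suc[symmetric]
    by (rule nn_integral_lborel_on_orthogonal)
       (simp_all add: completed_basis_cols[OF b] completed_basis_rows[OF b] del: sum.lessThan_Suc)
  also have "\<dots> = emeasure (lborel_on ?I) Q"
    by simp
  also have "\<dots> = (\<Prod>i\<in>?I. ennreal (real (Suc n)))"
    unfolding Q_def
    by (subst lborel_product.emeasure_PiM, simp, simp, intro prod.cong refl,
        subst emeasure_lborel_Icc) (auto simp del: of_nat_Suc)
  also have "\<dots> = ennreal (real (Suc n) ^ Suc n)"
    by (simp only: prod_constant card_lessThan ennreal_power of_nat_0_le_iff)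
  finally show ?thesis .
qed

lemma Vol_permutohedron_le:
  assumes b: "orthonormal_basis (Suc n) b"
  shows "Vol (Suc n) b (permutohedron (Suc n)) * sqrt (Suc n) \<le> real (Suc n) ^ Suc n"
proof -
  let ?M = "lborel_on {..<n}"
  define S where "S = {x \<in> space ?M. \<forall>i<Suc n. \<bar>\<Sum>k<n. x k * b k i\<bar> \<le> real n / 2}"
  define P where "P = {x \<in> {..<n} \<rightarrow>\<^sub>E UNIV. (\<Sum>k<n. x k *\<^sub>R b k) \<in> permutohedron (Suc n)}"
  have S [measurable]: "S \<in> sets ?M"
    unfolding S_def by measurable
  have le: "emeasure ?M S * ennreal (sqrt (Suc n)) \<le> ennreal (real (Suc n) ^ Suc n)"
    using emeasure_cube_section_le[OF b] by (simp add: S_def)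
  then have fin: "emeasure ?M S \<noteq> \<infinity>"
    by (auto simp: ennreal_top_mult top_unique)
  have "P \<subseteq> S"
    using permutohedron_subset_cube[of "Suc n"]
    by (force simp: P_def S_def space_PiM sum_fun_apply)
  \<comment> \<open>Measurability of \<open>P\<close> is not proved: if it fails,
    \<open>measure\<close> takes the default value 0 and the bound holds anyway.\<close>
  have "measure (completion ?M) P \<le> measure (completion ?M) S"
  proof (cases "P \<in> sets (completion ?M)")
    case True
    then show ?thesis
      using fin \<open>P \<subseteq> S\<close> by (intro measure_mono_fmeasurable) (auto simp: fmeasurable_def less_top)
  qed (simp add: measure_notin_sets)
  also have "\<dots> = measure ?M S"
    by simp
  finally have "Vol (Suc n) b (permutohedron (Suc n)) \<le> measure ?M S"
    by (simp add: Vol_def P_def)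
  moreover have "ennreal (measure ?M S * sqrt (Suc n)) \<le> ennreal (real (Suc n) ^ Suc n)"
    using le fin by (simp add: emeasure_eq_ennreal_measure ennreal_mult'')
  then have "measure ?M S * sqrt (Suc n) \<le> real (Suc n) ^ Suc n"
    by (subst (asm) ennreal_le_iff) auto
  ultimately show ?thesis
    using mult_right_mono[of _ "measure ?M S" "sqrt (Suc n)"] by (meson order_trans real_sqrt_ge_zero of_nat_0_le_iff)
qed

lemma Vol_circumball:
  assumes b: "orthonormal_basis (Suc n) b" and n: "n > 0"
  shows "Vol (Suc n) b (circumball (Suc n)) =
    unit_ball_vol n * L2_set (ybar (Suc n)) {..<Suc n} ^ n"
proof -
  let ?M = "lborel_on {..<n}" and ?R = "L2_set (ybar (Suc n)) {..<Suc n}"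
  \<comment> \<open>Here \<open>n > 0\<close> matters: for \<open>n = 0\<close> the vector
    \<open>ybar 1\<close> is zero and the ball degenerates to a point.\<close>
  have "?R > 0"
    unfolding L2_set_ybar using n by (intro real_sqrt_gt_zero divide_pos_pos mult_pos_pos)
      (simp_all add: power2_eq_square algebra_simps add_pos_pos)
  have L2: "L2_set (\<Sum>k<n. x k *\<^sub>R b k) {..<Suc n} = sqrt (\<Sum>k<n. (x k)\<^sup>2)" for x
    using sum_orthonormal_square[where K = "{..<n}" and I = "{..<Suc n}" and c = b and x = x] b
    by (simp add: L2_set_def sum_fun_apply orthonormal_basis_def del: sum.lessThan_Suc)
  have mem: "(\<Sum>k<n. x k *\<^sub>R b k) \<in> hyperplane (Suc n)" for x
    using orthonormal_basis_mem[OF b]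
    by (intro subspace_sum subspace_scale hyperplane_subspace) auto
  have "{x \<in> {..<n} \<rightarrow>\<^sub>E UNIV. (\<Sum>k<n. x k *\<^sub>R b k) \<in> circumball (Suc n)} =
      {x. sqrt (\<Sum>k<n. (x k)\<^sup>2) \<le> ?R} \<inter> space ?M"
    by (auto simp: circumball_def L2 mem space_PiM simp del: sum.lessThan_Suc)
  moreover have "\<dots> = {x \<in> space ?M. sqrt (\<Sum>k<n. (x k)\<^sup>2) \<le> ?R}"
    by auto
  moreover have "\<dots> \<in> sets ?M"
    by measurable
  ultimately have "Vol (Suc n) b (circumball (Suc n)) =
      measure ?M ({x. sqrt (\<Sum>k<n. (x k)\<^sup>2) \<le> ?R} \<inter> space ?M)"
    by (simp add: Vol_def)
  also have "\<dots> = unit_ball_vol n * ?R ^ n"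
    using emeasure_cball_aux[of "{..<n}" ?R] \<open>?R > 0\<close> by (simp add: measure_def)
  finally show ?thesis .
qed

section \<open>Asymptotics\<close>

text \<open>A crude Stirling bound at half-integers, by the recursion of Gamma in steps of 1. With
  the factor \<open>s\<close> in place of the sharp order \<open>sqrt s\<close>, the induction step
  amounts to (1 + 1/s)^(s+1) >= e, which follows from ln x <= x - 1. The loss is polynomial and
  hence harmless.\<close>

lemma Gamma_half_upper_bound:
  obtains C :: real where "C > 0"
    "\<And>n::nat. n > 0 \<Longrightarrow>
      Gamma (real n / 2 + 1) \<le> C * (real n / 2 * (real n / 2) powr (real n / 2) * exp (- (real n / 2)))"
proof -
  define F where "F s = exp (ln s + s * ln s - s)" for s :: real
  have F_pos: "F s > 0" for s
    by (simp add: F_def)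
  have F_step: "(s + 1) * F s \<le> F (s + 1)" if "s > 0" for s
  proof -
    have "ln (s / (s + 1)) \<le> s / (s + 1) - 1"
      using that by (intro ln_le_minus_one) auto
    then have "(s + 1) * (ln s - ln (s + 1)) \<le> (s + 1) * (s / (s + 1) - 1)"
      using that by (intro mult_left_mono) (auto simp: ln_div)
    also have "\<dots> = - 1"
      using that by (simp add: field_simps)
    finally have "ln (s + 1) + (ln s + s * ln s - s) \<le> ln (s + 1) + (s + 1) * ln (s + 1) - (s + 1)"
      by (simp add: algebra_simps)
    then have "exp (ln (s + 1)) * F s \<le> F (s + 1)"
      unfolding F_def exp_add[symmetric] by simp
    then show ?thesis
      using that by simp
  qed
  \<comment> \<open>The recursion runs separately through the half-odd and the integer arguments;
    the sum dominates both starting ratios, at 1/2 and at 1.\<close>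
  define C where "C = Gamma (1 / 2 + 1) / F (1 / 2) + Gamma (1 + 1) / F 1"
  have C: "C > 0"
    unfolding C_def using F_pos by (intro add_pos_pos divide_pos_pos Gamma_real_pos) auto
  have "Gamma (real (Suc n) / 2 + 1) \<le> C * F (real (Suc n) / 2)" for n
  proof (induction n rule: induct_nat_012)
    case 0
    have "Gamma (1 / 2 + 1) = Gamma (1 / 2 + 1) / F (1 / 2) * F (1 / 2)"
      using F_pos[of "1/2"] by simp
    also have "\<dots> \<le> C * F (1 / 2)"
      unfolding C_def using F_pos[of "1/2"] F_pos[of 1]
      by (intro mult_right_mono) (auto intro!: divide_nonneg_pos)
    finally show ?case
      by simp
  next
    case 1
    have "Gamma (1 + 1) = Gamma (1 + 1) / F 1 * F (1::real)"
      using F_pos[of 1] by simp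
    also have "\<dots> \<le> C * F 1"
      unfolding C_def using F_pos[of "1/2"] F_pos[of 1] Gamma_real_pos[of "1/2 + 1"]
      by (intro mult_right_mono) (auto intro!: divide_nonneg_pos)
    finally show ?case
      by simp
  next
    case (ge2 n)
    define s where "s = real (Suc n) / 2"
    have s: "s > 0"
      by (simp add: s_def)
    have "Gamma (s + 1 + 1) = (s + 1) * Gamma (s + 1)"
      using s by (intro Gamma_plus1) (auto elim!: nonpos_Ints_cases)
    also have "\<dots> \<le> (s + 1) * (C * F s)"
      using ge2(1) s by (intro mult_left_mono) (auto simp: s_def)
    also have "\<dots> = C * ((s + 1) * F s)"
      by simp
    also have "\<dots> \<le> C * F (s + 1)"
      using C F_step[OF s] by (intro mult_left_mono) auto
    finally show ?case
      by (simp add: s_def add_divide_distrib)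
  qed
  then have "Gamma (real n / 2 + 1) \<le> C * F (real n / 2)" if "n > 0" for n
    using that by (cases n) auto
  moreover have "F s = s * s powr s * exp (- s)" if "s > 0" for s
    using that by (simp add: F_def powr_def exp_add exp_diff exp_minus field_simps)
  ultimately show ?thesis
    using C by (intro that[of C]) auto
qed


lemma volume_ratio_le:
  assumes b: "orthonormal_basis (Suc n) b" and n: "n > 0"
    and Gamma: "Gamma (real n / 2 + 1) \<le>
      C * (real n / 2 * (real n / 2) powr (real n / 2) * exp (- (real n / 2)))"
  shows "Vol (Suc n) b (permutohedron (Suc n)) / Vol (Suc n) b (circumball (Suc n)) \<le>
    C * (real n / 2 * sqrt (Suc n) * (4 / 5) powr (real n / 2))"
proof -
  define s q where "s = real n / 2" and "q = real (Suc n)"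
  \<comment> \<open>The squared radius of the ball, with \<open>q\<^sup>2 - 1\<close> factored as
    \<open>n * (q + 1)\<close>.\<close>
  define X where "X = q * real n * (q + 1) / 12"
  let ?V = "Vol (Suc n) b (permutohedron (Suc n))" and ?R = "L2_set (ybar (Suc n)) {..<Suc n}"
  have pos: "s > 0" "q > 0" "X > 0"
    using n by (auto simp: s_def q_def X_def)
  have "?R = sqrt X"
    unfolding L2_set_ybar by (simp add: X_def q_def power2_eq_square algebra_simps)
  then have R: "?R ^ n = X powr s"
    using pos by (simp add: s_def powr_half_sqrt_powr powr_realpow real_sqrt_power)
  have qn: "q ^ n = (q * q) powr s"
    using pos by (simp add: s_def powr_mult powr_realpow flip: powr_add)
  \<comment> \<open>Positivity of \<open>C\<close> is forced by the hypothesis, since Gamma is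
    positive.\<close>
  have "C * (s * s powr s * exp (- s)) > 0"
    using Gamma Gamma_real_pos[of "s + 1"] pos unfolding s_def by linarith
  then have C: "C > 0"
    by (rule zero_less_mult_pos2) (use pos in auto)
  have "?V * sqrt q \<le> q ^ n * q"
    using Vol_permutohedron_le[OF b] unfolding q_def power_Suc2 .
  also have "\<dots> = q ^ n * sqrt q * sqrt q"
    using pos by simp
  finally have V: "?V \<le> q ^ n * sqrt q"
    using pos by (subst (asm) mult_le_cancel_right) auto
  \<comment> \<open>The base of the exponential part simplifies to
    \<open>6 * q / (exp 1 * pi * (q + 1))\<close>; the estimates e >= 5/2 and pi > 3 bring it below
    6 / 7.5 = 4/5.\<close>
  have base: "q * q * s / (exp 1 * pi * X) \<le> 4 / 5"
  proof -
    have "5 / 2 \<le> exp (1::real)"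
      using exp_lower_Taylor_quadratic[of 1] by simp
    then have "5 / 2 * 3 \<le> exp 1 * pi"
      using pi_gt3 by (intro mult_mono) auto
    then have "6 * q / (exp 1 * pi * (q + 1)) \<le> 6 * q / (5 / 2 * 3 * (q + 1))"
      using pos by (intro divide_left_mono mult_right_mono mult_pos_pos) auto
    also have "\<dots> \<le> 4 / 5"
      using pos by (simp add: field_simps)
    also have "6 * q / (exp 1 * pi * (q + 1)) = q * q * s / (exp 1 * pi * X)"
      using pos n by (simp add: X_def s_def)
    finally show ?thesis .
  qed
  have "?V / (unit_ball_vol n * ?R ^ n) = ?V * Gamma (s + 1) / (pi powr s * X powr s)"
    by (simp add: unit_ball_vol_def R flip: s_def)
  also have "\<dots> \<le> q ^ n * sqrt q * (C * (s * s powr s * exp (- s))) / (pi powr s * X powr s)"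
    using V Gamma pos C
    by (intro divide_right_mono mult_mono) (auto simp: s_def intro!: less_imp_le[OF Gamma_real_pos])
  also have "\<dots> = C * (s * sqrt q * ((q * q) powr s * s powr s / (exp 1 powr s * pi powr s * X powr s)))"
    by (simp add: qn exp_minus field_simps powr_def[of "exp 1"])
  also have "(q * q) powr s * s powr s / (exp 1 powr s * pi powr s * X powr s) =
      (q * q * s / (exp 1 * pi * X)) powr s"
    using pos by (simp add: powr_mult powr_divide)
  also have "C * (s * sqrt q * (q * q * s / (exp 1 * pi * X)) powr s) \<le> C * (s * sqrt q * (4 / 5) powr s)"
    using pos C base by (intro mult_left_mono powr_mono2) auto
  finally show ?thesis
    unfolding Vol_circumball[OF b n] s_def q_def .
qed

theorem proposition7p1:
  fixes b :: "nat \<Rightarrow> nat \<Rightarrow> nat \<Rightarrow> real"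
  assumes "\<And>q. q \<ge> 2 \<Longrightarrow> orthonormal_basis q (b q)"
  shows "geometric_rate_to_0 (\<lambda>q. Vol q (b q) (permutohedron q) / Vol q (b q) (circumball q))"
proof -
  let ?r = "\<lambda>q. Vol q (b q) (permutohedron q) / Vol q (b q) (circumball q)"
  obtain C :: real where C: "C > 0"
    "\<And>n::nat. n > 0 \<Longrightarrow>
      Gamma (real n / 2 + 1) \<le> C * (real n / 2 * (real n / 2) powr (real n / 2) * exp (- (real n / 2)))"
    using Gamma_half_upper_bound by metis
  have pow: "(4 / 5) powr (real n / 2) \<le> (9 / 10) ^ n" for n
  proof -
    have "sqrt (4 / 5) \<le> 9 / 10"
      by (rule real_le_lsqrt) (auto simp: power2_eq_square)
    then show ?thesis
      by (simp add: powr_half_sqrt_powr powr_realpow real_sqrt_power power_mono)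
  qed
  \<comment> \<open>The gap between 9/10 and 19/20 absorbs the polynomial factor. The extra 19/20 on
    the right accounts for the index shift \<open>q = Suc n\<close>.\<close>
  have "eventually (\<lambda>n. real n / 2 * sqrt (1 + real n) * (9 / 10) ^ n \<le> (19 / 20) * (19 / 20) ^ n) sequentially"
    by real_asymp
  then have "eventually (\<lambda>n. ?r (Suc n) \<le> C * (19 / 20) ^ Suc n) sequentially"
    using eventually_gt_at_top[of 0]
  proof eventually_elim
    case (elim n)
    have "?r (Suc n) \<le> C * (real n / 2 * sqrt (Suc n) * (4 / 5) powr (real n / 2))"
      using elim by (intro volume_ratio_le C assms) auto
    also have "\<dots> \<le> C * (19 / 20) ^ Suc n"
      using elim(1) C(1) mult_left_mono[OF pow[of n], of "real n / 2 * sqrt (1 + real n)"]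
      by (intro mult_left_mono) (auto elim: order_trans[rotated])
    finally show ?case .
  qed
  then have "eventually (\<lambda>q. ?r q \<le> C * (19 / 20) ^ q) sequentially"
    by (subst (asm) eventually_sequentially_Suc)
  \<comment> \<open>Nonnegativity is required for every \<open>q\<close>, including
    \<open>q < 2\<close> where \<open>b q\<close> is arbitrary; it holds because both volumes are
    measures.\<close>
  moreover have "0 \<le> ?r q" for q
    by (simp add: Vol_def)
  ultimately show ?thesis
    unfolding geometric_rate_to_0_def using C(1)
    by (intro conjI allI exI[of _ C] exI[of _ "19 / 20"]) auto
qed

end
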